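(* Let $G$ be a finite abelian group. Every subgroup of $\operatorname{Aut}(G)\ltimes G^2$ is of the form $$(\{1\}\ltimes Q)\cdot\langle (h_1,X_1),\ldots,(h_r,X_r)\rangle$$ where $Q$ is a subgroup of $G^2$, $X_1,\ldots,X_r\in G^2$, and $\{h_1,\ldots,h_r\}$ is a (minimal) set of generators for some subgroup $H$ of $\operatorname{Aut}(G)$. Conversely, these are always subgroups of $\operatorname{Aut}(G)\ltimes G^2$.
   Context: $\operatorname{Aut}(G)$ is the automorphism group of $G$ (written additively), acting componentwise on $G^2=G\times G$. $\operatorname{Aut}(G)\ltimes G^2$ is the set $\operatorname{Aut}(G)\times G^2$ with multiplication $(h,X)(h',X')=(hh',hX'+X)$. $\{1\}\ltimes Q$ denotes $\{(1,X): X\in Q\}$, $\langle\cdots\rangle$ denotes the subgroup generated, and for subsets $A,B$ of a group, $A\cdot B=\{ab: a\in A,\ b\in B\}$.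
   Formalization: The converse fails for arbitrary Q (e.g. G=(Z/2)^2, h the coordinate swap, Q={0,((1,0),0)}, X_1=0), so it is stated for subgroups Q stable under H; stability of Q is also shown in the forward direction. *)

theory Defs
  imports "HOL-Algebra.Bij" "HOL-Algebra.Generated_Groups"
begin

text \<open>
  The finite abelian group \<open>G\<close> is a multiplicatively written \<^locale>\<open>comm_group\<close>. Elements of
  \<^const>\<open>AutoGroup\<close> are extensional functions, so that each automorphism of \<open>G\<close> has exactly one
  representative. The product is \<open>(h, X)(h', X') = (hh', h X' + X)\<close>.
\<close>

definition AutSemidirect :: "('a, 'b) monoid_scheme \<Rightarrow> (('a \<Rightarrow> 'a) \<times> ('a \<times> 'a)) monoid" where
  "AutSemidirect G =
    \<lparr>carrier = carrier (AutoGroup G) \<times> carrier (G \<times>\<times> G),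
     mult = (\<lambda>(h, x) (h', x'). (h \<otimes>\<^bsub>AutoGroup G\<^esub> h', map_prod h h x' \<otimes>\<^bsub>G \<times>\<times> G\<^esub> x)),
     one = (\<one>\<^bsub>AutoGroup G\<^esub>, \<one>\<^bsub>G \<times>\<times> G\<^esub>)\<rparr>"

definition trivial_semidirect :: "('a, 'b) monoid_scheme \<Rightarrow> ('a \<times> 'a) set \<Rightarrow> (('a \<Rightarrow> 'a) \<times> ('a \<times> 'a)) set" where
  "trivial_semidirect G Q = {\<one>\<^bsub>AutoGroup G\<^esub>} \<times> Q"

definition generating_set :: "('a, 'b) monoid_scheme \<Rightarrow> 'a set \<Rightarrow> 'a set \<Rightarrow> bool" where
  "generating_set G H A \<longleftrightarrow> A \<subseteq> carrier G \<and> generate G A = H"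

definition minimal_generating_set :: "('a, 'b) monoid_scheme \<Rightarrow> 'a set \<Rightarrow> 'a set \<Rightarrow> bool" where
  "minimal_generating_set G H A \<longleftrightarrow>
     generating_set G H A \<and> (\<forall>B. B \<subset> A \<longrightarrow> \<not> generating_set G H B)"

text \<open>
  Stability of \<open>Q\<close> under \<open>H\<close> cannot be dropped when one asks for
  \<open>({1} \<ltimes> Q) \<cdot> \<langle>(h\<^sub>1, X\<^sub>1), \<dots>, (h\<^sub>r, X\<^sub>r)\<rangle>\<close> to be a subgroup: for \<open>G = (\<int>/2)\<^sup>2\<close>,
  \<open>Q = {0, ((1,0), 0)}\<close> and \<open>h\<close> the coordinate swap, the set \<open>({1} \<ltimes> Q) \<cdot> \<langle>(h, 0)\<rangle>\<close> contains
  \<open>(h, 0)\<close> and \<open>(1, ((1,0), 0))\<close>, but not their product \<open>(h, ((0,1), 0))\<close>.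
\<close>

definition stable_under :: "('a \<Rightarrow> 'a) set \<Rightarrow> ('a \<times> 'a) set \<Rightarrow> bool" where
  "stable_under H Q \<longleftrightarrow> (\<forall>k\<in>H. map_prod k k ` Q \<subseteq> Q)"

lemma AutoGroup_mult_apply:
  "h \<in> carrier (AutoGroup G) \<Longrightarrow> h' \<in> carrier (AutoGroup G) \<Longrightarrow> x \<in> carrier G \<Longrightarrow>
   (h \<otimes>\<^bsub>AutoGroup G\<^esub> h') x = h (h' x)"
  by (simp add: AutoGroup_def BijGroup_def auto_def compose_eq)

lemma AutoGroup_one_apply: "x \<in> carrier G \<Longrightarrow> \<one>\<^bsub>AutoGroup G\<^esub> x = x"
  by (simp add: AutoGroup_def BijGroup_def)

lemma AutoGroup_hom: "h \<in> carrier (AutoGroup G) \<Longrightarrow> h \<in> hom G G"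
  by (simp add: AutoGroup_def auto_def)

lemma group_AutSemidirect:
  assumes "comm_group G"
  shows "group (AutSemidirect G)"
proof -
  interpret comm_group G by fact
  interpret A: group "AutoGroup G" by (rule AutoGroup)
  have closed: "h x \<in> carrier G" if "h \<in> carrier (AutoGroup G)" "x \<in> carrier G" for h x
    using AutoGroup_hom[OF that(1)] that(2) by (auto simp: hom_def)
  have hmult: "h (x \<otimes>\<^bsub>G\<^esub> y) = h x \<otimes>\<^bsub>G\<^esub> h y"
    if "h \<in> carrier (AutoGroup G)" "x \<in> carrier G" "y \<in> carrier G" for h x y
    using AutoGroup_hom[OF that(1)] that(2,3) by (auto simp: hom_def)
  have hone: "h \<one>\<^bsub>G\<^esub> = \<one>\<^bsub>G\<^esub>" if "h \<in> carrier (AutoGroup G)" for h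
    using hom_one[OF AutoGroup_hom[OF that]] is_group by simp
  show ?thesis
  proof (rule groupI)
    fix x y z
    assume "x \<in> carrier (AutSemidirect G)" "y \<in> carrier (AutSemidirect G)"
      "z \<in> carrier (AutSemidirect G)"
    then show "x \<otimes>\<^bsub>AutSemidirect G\<^esub> y \<otimes>\<^bsub>AutSemidirect G\<^esub> z =
               x \<otimes>\<^bsub>AutSemidirect G\<^esub> (y \<otimes>\<^bsub>AutSemidirect G\<^esub> z)"
      by (auto simp: AutSemidirect_def AutoGroup_mult_apply A.m_assoc hmult closed m_assoc)
  next
    fix x
    assume "x \<in> carrier (AutSemidirect G)"
    then obtain h a b where x: "x = (h, a, b)" "h \<in> carrier (AutoGroup G)"
      "a \<in> carrier G" "b \<in> carrier G"
      by (auto simp: AutSemidirect_def)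
    let ?k = "inv\<^bsub>AutoGroup G\<^esub> h"
    let ?y = "(?k, ?k (inv\<^bsub>G\<^esub> a), ?k (inv\<^bsub>G\<^esub> b))"
    have "?y \<in> carrier (AutSemidirect G)"
      using x by (simp add: AutSemidirect_def closed)
    moreover have "?y \<otimes>\<^bsub>AutSemidirect G\<^esub> x = \<one>\<^bsub>AutSemidirect G\<^esub>"
      using x hmult[of ?k, symmetric] by (simp add: AutSemidirect_def hone)
    ultimately show "\<exists>y\<in>carrier (AutSemidirect G). y \<otimes>\<^bsub>AutSemidirect G\<^esub> x = \<one>\<^bsub>AutSemidirect G\<^esub>"
      by blast
  qed (auto simp: AutSemidirect_def closed AutoGroup_one_apply)
qed

end

theory Submission
  imports Defs
begin

text \<open>
  The first projection is a homomorphism from \<open>Aut(G) \<ltimes> G\<^sup>2\<close> onto \<open>Aut(G)\<close> with kernel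
  \<open>{1} \<ltimes> G\<^sup>2\<close>. A subgroup \<open>S\<close> meets the kernel in some \<open>{1} \<ltimes> Q\<close> and projects onto some \<open>H\<close>; if
  elements of \<open>S\<close> lift a minimal generating set of \<open>H\<close>, they generate a subgroup of \<open>S\<close> that also
  projects onto \<open>H\<close>, so \<open>S\<close> is the product of \<open>{1} \<ltimes> Q\<close> with this subgroup.
  Conversely, conjugation by \<open>(k, Y)\<close> acts on \<open>{1} \<ltimes> G\<^sup>2\<close> as \<open>k\<close>, so the subgroup generated by the
  \<open>(h\<^sub>i, X\<^sub>i)\<close> normalizes \<open>{1} \<ltimes> Q\<close> as soon as \<open>Q\<close> is stable under \<open>H\<close>.
\<close>

section \<open>Products of subgroups in a general group\<close>

text \<open>Factors from \<open>K\<close> can be moved to the right past factors from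
  \<open>N\<close>, so inverses and products of elements \<open>n \<otimes> k\<close> return to this
  form. One direction of the exchange suffices, since \<open>K\<close> contains its
  inverses.\<close>

lemma (in group) subgroup_set_mult_if_normalizes:
  assumes N: "subgroup N G" and K: "subgroup K G"
    and conj: "\<And>k n. k \<in> K \<Longrightarrow> n \<in> N \<Longrightarrow> \<exists>n'\<in>N. k \<otimes> n = n' \<otimes> k"
  shows "subgroup (N <#> K) G"
proof (rule subgroupI)
  note carr[simp] = subgroup.mem_carrier[OF N] subgroup.mem_carrier[OF K]
  show "N <#> K \<subseteq> carrier G"
    by (auto simp: set_mult_def)
  show "N <#> K \<noteq> {}"
    using subgroup.one_closed[OF N] subgroup.one_closed[OF K] by (auto simp: set_mult_def)
  fix a assume "a \<in> N <#> K"
  then obtain n k where a: "a = n \<otimes> k" "n \<in> N" "k \<in> K"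
    by (auto simp: set_mult_def)
  \<comment> \<open>The inverse of \<open>n \<otimes> k\<close> is
    \<open>inv k \<otimes> inv n\<close>, with the factors in the wrong order; the exchange is
    therefore applied to the inverses.\<close>
  then obtain m where "m \<in> N" "inv k \<otimes> inv n = m \<otimes> inv k"
    using conj[of "inv k" "inv n"] subgroup.m_inv_closed[OF N] subgroup.m_inv_closed[OF K]
    by auto
  then show "inv a \<in> N <#> K"
    using a subgroup.m_inv_closed[OF K] by (auto simp: set_mult_def inv_mult_group)
  fix b assume "b \<in> N <#> K"
  then obtain n' k' where b: "b = n' \<otimes> k'" "n' \<in> N" "k' \<in> K"
    by (auto simp: set_mult_def)
  from conj[OF a(3) b(2)] obtain m' where m': "m' \<in> N" "k \<otimes> n' = m' \<otimes> k"
    by auto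
  have "a \<otimes> b = n \<otimes> (k \<otimes> n') \<otimes> k'"
    using a b by (simp add: m_assoc)
  also have "\<dots> = (n \<otimes> m') \<otimes> (k \<otimes> k')"
    using a b m' by (simp add: m_assoc)
  finally show "a \<otimes> b \<in> N <#> K"
    using subgroup.m_closed[OF N a(2) m'(1)] subgroup.m_closed[OF K a(3) b(3)]
    unfolding set_mult_def by blast
qed

text \<open>An element \<open>s\<close> of \<open>S\<close> has the same image as some
  \<open>t\<close> in \<open>K\<close>, so \<open>s \<otimes> inv t\<close> lies in the kernel, and
  in \<open>S\<close> because \<open>K \<subseteq> S\<close>.\<close>

lemma (in group_hom) subgroup_eq_set_mult_if_img_eq:
  assumes S: "subgroup S G" and K: "subgroup K G" and "K \<subseteq> S" and img: "h ` K = h ` S"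
  shows "S = (S \<inter> kernel G H h) <#> K"
proof
  note carr[simp] = subgroup.mem_carrier[OF S] subgroup.mem_carrier[OF K]
  show "(S \<inter> kernel G H h) <#> K \<subseteq> S"
    using \<open>K \<subseteq> S\<close> subgroup.m_closed[OF S] by (auto simp: set_mult_def)
  show "S \<subseteq> (S \<inter> kernel G H h) <#> K"
  proof
    fix s assume s: "s \<in> S"
    with img obtain t where t: "t \<in> K" "h t = h s"
      by (metis imageE imageI)
    have "s \<otimes> inv t \<in> S \<inter> kernel G H h"
      using s t \<open>K \<subseteq> S\<close> subgroup.m_closed[OF S] subgroup.m_inv_closed[OF S]
      by (auto simp: kernel_def)
    moreover have "s = s \<otimes> inv t \<otimes> t"
      using s t by (simp add: G.m_assoc)
    ultimately show "s \<in> (S \<inter> kernel G H h) <#> K"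
      using t(1) unfolding set_mult_def by blast
  qed
qed

section \<open>Finiteness and minimal generating sets\<close>

text \<open>Extensionality fixes the values outside the carrier, which places the automorphisms in a
  finite function space.\<close>

lemma finite_AutoGroup:
  assumes "finite (carrier G)"
  shows "finite (carrier (AutoGroup G))"
proof (rule finite_subset)
  show "carrier (AutoGroup G) \<subseteq> carrier G \<rightarrow>\<^sub>E carrier G"
    by (auto simp: AutoGroup_def auto_def hom_def Bij_def PiE_def)
  show "finite (carrier G \<rightarrow>\<^sub>E carrier G)"
    using assms by (intro finite_PiE)
qed

text \<open>The generating sets contained in \<open>H\<close> form a finite family, nonempty because
  \<open>H\<close> generates itself; an inclusion-minimal member is taken.\<close>

lemma (in group) exists_minimal_generating_set:
  assumes H: "subgroup H G" and "finite H"
  shows "\<exists>A. minimal_generating_set G H A"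
proof -
  define F where "F = {A. A \<subseteq> H \<and> generating_set G H A}"
  have "generate G H = H"
    using generate_subgroup_incl[OF subset_refl H] generate.incl by fast
  then have "H \<in> F"
    using subgroup.subset[OF H] by (simp add: F_def generating_set_def)
  moreover have "finite F"
    using \<open>finite H\<close> by (simp add: F_def)
  ultimately obtain A where "A \<in> F" and min: "\<And>B. B \<in> F \<Longrightarrow> B \<subseteq> A \<Longrightarrow> A = B"
    using finite_has_minimal[of F] by blast
  then have "A \<subseteq> H" "generating_set G H A"
    by (auto simp: F_def)
  \<comment> \<open>Minimality within \<open>F\<close> extends to all proper subsets of
    \<open>A\<close>, since these are again contained in \<open>H\<close>.\<close>
  moreover have "\<not> generating_set G H B" if "B \<subset> A" for B
    using min[of B] that \<open>A \<subseteq> H\<close> by (auto simp: F_def)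
  ultimately have "minimal_generating_set G H A"
    unfolding minimal_generating_set_def by blast
  then show ?thesis ..
qed

section \<open>The semidirect product: projection, embedding, conjugation\<close>

locale aut_semidirect = comm_group G for G (structure)
begin

abbreviation "P \<equiv> AutSemidirect G"

sublocale A: group "AutoGroup G"
  by (rule AutoGroup)

sublocale D: group "G \<times>\<times> G"
  by (intro DirProd_group is_group)

sublocale P: group P
  by (intro group_AutSemidirect comm_group_axioms)

sublocale fst: group_hom P "AutoGroup G" fst
  by unfold_locales (auto simp: hom_def AutSemidirect_def)

text \<open>The translation parts are \<open>k q + y\<close> on the left and \<open>y + k q\<close>
  on the right, equal because \<open>G\<close> is commutative.\<close>

lemma conj_trivial_semidirect:
  assumes "(k, y) \<in> carrier P" "q \<in> carrier (G \<times>\<times> G)"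
  shows "(k, y) \<otimes>\<^bsub>P\<^esub> (\<one>\<^bsub>AutoGroup G\<^esub>, q) = (\<one>\<^bsub>AutoGroup G\<^esub>, map_prod k k q) \<otimes>\<^bsub>P\<^esub> (k, y)"
proof -
  have "k a \<in> carrier G" if "a \<in> carrier G" for a
    using AutoGroup_hom[of k G] assms that by (auto simp: AutSemidirect_def hom_def)
  then show ?thesis
    using assms by (cases q; cases y) (auto simp: AutSemidirect_def AutoGroup_one_apply m_comm)
qed

text \<open>The product rule yields \<open>y + x\<close>, in reversed order; commutativity makes the
  embedding of G^2 a homomorphism.\<close>

lemma mult_trivial_semidirect:
  assumes "x \<in> carrier (G \<times>\<times> G)" "y \<in> carrier (G \<times>\<times> G)"
  shows "(\<one>\<^bsub>AutoGroup G\<^esub>, x) \<otimes>\<^bsub>P\<^esub> (\<one>\<^bsub>AutoGroup G\<^esub>, y) = (\<one>\<^bsub>AutoGroup G\<^esub>, x \<otimes>\<^bsub>G \<times>\<times> G\<^esub> y)"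
  using assms by (cases x; cases y) (auto simp: AutSemidirect_def AutoGroup_one_apply m_comm)

lemma embed_hom: "group_hom (G \<times>\<times> G) P (Pair \<one>\<^bsub>AutoGroup G\<^esub>)"
  by unfold_locales (auto simp: hom_def mult_trivial_semidirect, auto simp: AutSemidirect_def)

lemma subgroup_trivial_semidirect:
  assumes "subgroup Q (G \<times>\<times> G)"
  shows "subgroup (trivial_semidirect G Q) P"
proof -
  have "trivial_semidirect G Q = Pair \<one>\<^bsub>AutoGroup G\<^esub> ` Q"
    by (auto simp: trivial_semidirect_def)
  then show ?thesis
    using group_hom.subgroup_img_is_subgroup[OF embed_hom assms] by simp
qed

text \<open>This preimage of \<open>S\<close> under the embedding of G^2 serves as \<open>Q\<close>
  in the decomposition of \<open>S\<close>.\<close>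

lemma subgroup_vimage_embed:
  assumes S: "subgroup S P"
  shows "subgroup {q. (\<one>\<^bsub>AutoGroup G\<^esub>, q) \<in> S} (G \<times>\<times> G)"
proof -
  interpret e: group_hom "G \<times>\<times> G" P "Pair \<one>\<^bsub>AutoGroup G\<^esub>"
    by (rule embed_hom)
  show ?thesis
  proof (rule D.subgroupI)
    show sub: "{q. (\<one>\<^bsub>AutoGroup G\<^esub>, q) \<in> S} \<subseteq> carrier (G \<times>\<times> G)"
      using subgroup.subset[OF S] by (auto simp: AutSemidirect_def)
    show "{q. (\<one>\<^bsub>AutoGroup G\<^esub>, q) \<in> S} \<noteq> {}"
      using subgroup.one_closed[OF S] by (auto simp: AutSemidirect_def)
    fix a assume a: "a \<in> {q. (\<one>\<^bsub>AutoGroup G\<^esub>, q) \<in> S}"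
    with sub have "a \<in> carrier (G \<times>\<times> G)" by blast
    then show "inv\<^bsub>G \<times>\<times> G\<^esub> a \<in> {q. (\<one>\<^bsub>AutoGroup G\<^esub>, q) \<in> S}"
      using e.hom_inv subgroup.m_inv_closed[OF S] a by auto
    fix b assume b: "b \<in> {q. (\<one>\<^bsub>AutoGroup G\<^esub>, q) \<in> S}"
    with sub have "b \<in> carrier (G \<times>\<times> G)" by blast
    then show "a \<otimes>\<^bsub>G \<times>\<times> G\<^esub> b \<in> {q. (\<one>\<^bsub>AutoGroup G\<^esub>, q) \<in> S}"
      using e.hom_mult \<open>a \<in> carrier (G \<times>\<times> G)\<close> subgroup.m_closed[OF S] a b by auto
  qed
qed

text \<open>\<open>S\<close> is closed under conjugation by its own elements, and conjugation by
  \<open>(k, y)\<close> acts on the embedded G^2 as \<open>k\<close>.\<close>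

lemma stable_under_vimage_embed:
  assumes S: "subgroup S P"
  shows "stable_under (fst ` S) {q. (\<one>\<^bsub>AutoGroup G\<^esub>, q) \<in> S}"
  unfolding stable_under_def
proof (intro ballI subsetI)
  fix k p
  assume "k \<in> fst ` S" "p \<in> map_prod k k ` {q. (\<one>\<^bsub>AutoGroup G\<^esub>, q) \<in> S}"
  then obtain y q where ky: "(k, y) \<in> S" and q: "(\<one>\<^bsub>AutoGroup G\<^esub>, q) \<in> S" and p: "p = map_prod k k q"
    by force
  note carr = subgroup.mem_carrier[OF S]
  have qc: "q \<in> carrier (G \<times>\<times> G)"
    using carr[OF q] by (auto simp: AutSemidirect_def)
  have kyc: "(k, y) \<in> carrier P"
    by (rule carr[OF ky])
  have "p \<in> carrier (G \<times>\<times> G)"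
    using kyc qc AutoGroup_hom[of k G] by (auto simp: p AutSemidirect_def hom_def)
  \<comment> \<open>Membership in the carrier is what permits cancelling \<open>(k, y)\<close>
    against its inverse in the next step.\<close>
  then have "(\<one>\<^bsub>AutoGroup G\<^esub>, p) \<in> carrier P"
    by (auto simp: AutSemidirect_def)
  then have "(\<one>\<^bsub>AutoGroup G\<^esub>, p) = (k, y) \<otimes>\<^bsub>P\<^esub> (\<one>\<^bsub>AutoGroup G\<^esub>, q) \<otimes>\<^bsub>P\<^esub> inv\<^bsub>P\<^esub> (k, y)"
    using conj_trivial_semidirect[OF kyc qc] kyc by (simp add: p P.m_assoc)
  then show "p \<in> {q. (\<one>\<^bsub>AutoGroup G\<^esub>, q) \<in> S}"
    using ky q subgroup.m_closed[OF S] subgroup.m_inv_closed[OF S] by simp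
qed

section \<open>Decomposition of subgroups and the converse\<close>

lemma ex_decomposition:
  assumes fin: "finite (carrier G)" and S: "subgroup S P"
  shows "\<exists>Q H (r :: nat) h x.
           subgroup Q (G \<times>\<times> G) \<and> subgroup H (AutoGroup G) \<and> stable_under H Q \<and>
           inj_on h {1..r} \<and> minimal_generating_set (AutoGroup G) H (h ` {1..r}) \<and>
           (\<forall>i\<in>{1..r}. x i \<in> carrier (G \<times>\<times> G)) \<and>
           S = trivial_semidirect G Q <#>\<^bsub>P\<^esub> generate P ((\<lambda>i. (h i, x i)) ` {1..r})"
proof -
  let ?H = "fst ` S" and ?Q = "{q. (\<one>\<^bsub>AutoGroup G\<^esub>, q) \<in> S}"
  have H: "subgroup ?H (AutoGroup G)"
    by (rule fst.subgroup_img_is_subgroup[OF S])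
  then have "finite ?H"
    using finite_AutoGroup[OF fin] finite_subset subgroup.subset by blast
  with H obtain A where A: "minimal_generating_set (AutoGroup G) ?H A"
    using A.exists_minimal_generating_set by blast
  then have genA: "A \<subseteq> carrier (AutoGroup G)" "generate (AutoGroup G) A = ?H"
    by (auto simp: minimal_generating_set_def generating_set_def)
  then have "finite A" "A \<subseteq> ?H"
    using finite_subset[OF _ finite_AutoGroup[OF fin]] generate.incl[of _ A "AutoGroup G"] by blast+
  \<comment> \<open>A bijective enumeration gives \<open>r = card A\<close> and distinct generators;
    for trivial \<open>?H\<close> the index set \<open>{1..0}\<close> is empty.\<close>
  then obtain h where h: "bij_betw h {1..card A} A"
    using ex_bij_betw_nat_finite_1 by blast
  \<comment> \<open>Each generator lies in the projection of \<open>S\<close>, so it has a lift in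
    \<open>S\<close>; the second components of chosen lifts become the \<open>x i\<close>.\<close>
  then have "\<forall>i\<in>{1..card A}. \<exists>y. (h i, y) \<in> S"
    using \<open>A \<subseteq> ?H\<close> by (force simp: bij_betw_def)
  then obtain x where x: "\<And>i. i \<in> {1..card A} \<Longrightarrow> (h i, x i) \<in> S"
    by metis
  let ?X = "(\<lambda>i. (h i, x i)) ` {1..card A}"
  have XS: "?X \<subseteq> S" and XP: "?X \<subseteq> carrier P"
    using x subgroup.subset[OF S] by auto
  have "fst ` generate P ?X = generate (AutoGroup G) (fst ` ?X)"
    using fst.generate_img[OF XP] by simp
  also have "fst ` ?X = A"
    using h by (simp add: image_image bij_betw_def)
  finally have img: "fst ` generate P ?X = ?H"
    using genA by simp
  have "S = (S \<inter> kernel P (AutoGroup G) fst) <#>\<^bsub>P\<^esub> generate P ?X"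
    using S P.generate_is_subgroup[OF XP] P.generate_subgroup_incl[OF XS S] img
    by (rule fst.subgroup_eq_set_mult_if_img_eq)
  also have "S \<inter> kernel P (AutoGroup G) fst = trivial_semidirect G ?Q"
    using subgroup.subset[OF S] by (auto simp: kernel_def trivial_semidirect_def)
  finally have "S = trivial_semidirect G ?Q <#>\<^bsub>P\<^esub> generate P ?X" .
  moreover have "x i \<in> carrier (G \<times>\<times> G)" if "i \<in> {1..card A}" for i
    using x[OF that] subgroup.subset[OF S] by (auto simp: AutSemidirect_def)
  moreover have "inj_on h {1..card A}" "h ` {1..card A} = A"
    using h by (auto simp: bij_betw_def)
  ultimately show ?thesis
    using subgroup_vimage_embed[OF S] H stable_under_vimage_embed[OF S] A
    by (intro exI[of _ ?Q] exI[of _ ?H] exI[of _ "card A"] exI[of _ h] exI[of _ x]) simp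
qed

lemma subgroup_set_mult_generate:
  assumes Q: "subgroup Q (G \<times>\<times> G)" and stable: "stable_under H Q"
    and X: "X \<subseteq> carrier P" and H: "generate (AutoGroup G) (fst ` X) = H"
  shows "subgroup (trivial_semidirect G Q <#>\<^bsub>P\<^esub> generate P X) P"
proof (rule P.subgroup_set_mult_if_normalizes)
  show "subgroup (trivial_semidirect G Q) P"
    by (rule subgroup_trivial_semidirect[OF Q])
  show K: "subgroup (generate P X) P"
    by (rule P.generate_is_subgroup[OF X])
  fix k n assume k: "k \<in> generate P X" and n: "n \<in> trivial_semidirect G Q"
  obtain g y where ky: "k = (g, y)" by (rule prod.exhaust)
  \<comment> \<open>Projection commutes with generation, so first components of generated elements
    lie in \<open>H\<close>, where stability of \<open>Q\<close> applies.\<close>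
  have "g \<in> H"
    using fst.generate_img[OF X] H k by (force simp: ky)
  from n obtain q where q: "n = (\<one>\<^bsub>AutoGroup G\<^esub>, q)" "q \<in> Q"
    by (auto simp: trivial_semidirect_def)
  have "(\<one>\<^bsub>AutoGroup G\<^esub>, map_prod g g q) \<in> trivial_semidirect G Q"
    using stable \<open>g \<in> H\<close> q by (auto simp: stable_under_def trivial_semidirect_def)
  moreover have "k \<otimes>\<^bsub>P\<^esub> n = (\<one>\<^bsub>AutoGroup G\<^esub>, map_prod g g q) \<otimes>\<^bsub>P\<^esub> k"
    using subgroup.mem_carrier[OF K k] subgroup.mem_carrier[OF Q q(2)]
    unfolding ky q by (rule conj_trivial_semidirect)
  ultimately show "\<exists>n'\<in>trivial_semidirect G Q. k \<otimes>\<^bsub>P\<^esub> n = n' \<otimes>\<^bsub>P\<^esub> k"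
    by blast
qed

end

theorem proposition3p1:
  fixes G :: "('a, 'b) monoid_scheme"
  assumes "comm_group G" and "finite (carrier G)"
  shows
    "(\<forall>S. subgroup S (AutSemidirect G) \<longrightarrow>
        (\<exists>Q H (r :: nat) h x.
           subgroup Q (G \<times>\<times> G) \<and> subgroup H (AutoGroup G) \<and> stable_under H Q \<and>
           inj_on h {1..r} \<and> minimal_generating_set (AutoGroup G) H (h ` {1..r}) \<and>
           (\<forall>i\<in>{1..r}. x i \<in> carrier (G \<times>\<times> G)) \<and>
           S = trivial_semidirect G Q <#>\<^bsub>AutSemidirect G\<^esub>
                 generate (AutSemidirect G) ((\<lambda>i. (h i, x i)) ` {1..r})))
   \<and> (\<forall>Q H (r :: nat) h x.
        subgroup Q (G \<times>\<times> G) \<and> subgroup H (AutoGroup G) \<and> stable_under H Q \<and>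
        generating_set (AutoGroup G) H (h ` {1..r}) \<and>
        (\<forall>i\<in>{1..r}. x i \<in> carrier (G \<times>\<times> G)) \<longrightarrow>
        subgroup (trivial_semidirect G Q <#>\<^bsub>AutSemidirect G\<^esub>
                    generate (AutSemidirect G) ((\<lambda>i. (h i, x i)) ` {1..r}))
          (AutSemidirect G))"
proof -
  interpret aut_semidirect G
    using assms(1) by (rule aut_semidirect.intro)
  show ?thesis
  proof (intro conjI allI impI, goal_cases)
    case (1 S)
    then show ?case
      by (rule ex_decomposition[OF assms(2)])
  next
    case (2 Q H r h x)
    let ?X = "(\<lambda>i. (h i, x i)) ` {1..r}"
    have "?X \<subseteq> carrier P"
      using 2 by (auto simp: AutSemidirect_def generating_set_def)
    moreover have "generate (AutoGroup G) (fst ` ?X) = H"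
      using 2 by (simp add: generating_set_def image_image)
    ultimately show ?case
      using 2 by (intro subgroup_set_mult_generate) auto
  qed
qed

end
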